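(* There are constants $\alpha_n>0$ and $A_n>1$, depending only on $n$, such that every nonconstant (i.e. not almost everywhere equal to a constant) $f\in\mathrm{BLO}(\mathbb{R}^n)$ satisfies $$\sup_{x\in\mathbb{R}^n,\,t>0}\frac1{\vartheta_n}\int_{B(x,\sqrt t)}W_t(x-y)\exp\left(\frac{\alpha_n\big(f(y)-\operatorname{ess\,inf}_{z\in B(x,\sqrt t)}f(z)\big)}{\|f\|_{\mathrm{BLO}(\mathbb{R}^n)}}\right)dy\le A_n.$$ Conversely, if $f\in L^1_{\mathrm{loc}}(\mathbb{R}^n)$ and for some $\lambda>0$ and $A\ge1$, $$\sup_{x\in\mathbb{R}^n,\,t>0}\frac1{\vartheta_n}\int_{B(x,\sqrt t)}W_t(x-y)\,e^{\lambda\left(f(y)-\operatorname{ess\,inf}_{z\in B(x,\sqrt t)}f(z)\right)}\,dy\le A,$$ then $f\in\mathrm{BLO}(\mathbb{R}^n)$ and $$\|f\|_{\mathrm{BLO}(\mathbb{R}^n)}\le\frac{e^{1/4}}{\lambda}\log A.$$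
   Context: $\mathrm{BLO}(\mathbb{R}^n)$ is the set of real-valued locally integrable functions $f$ on $\mathbb{R}^n$ with $\|f\|_{\mathrm{BLO}(\mathbb{R}^n)}:=\sup_B\frac1{|B|}\int_B\big[f(x)-\operatorname{ess\,inf}_B f\big]\,dx<\infty$, the supremum being over all balls $B\subset\mathbb{R}^n$. If an essential infimum over a ball is $-\infty$, the corresponding exponential integral is $+\infty$. $W_t(x-y)=(4\pi t)^{-n/2}\exp(-|x-y|^2/(4t))$, $t>0$, is the heat kernel, $B(x,r)$ is the ball of center $x$ and radius $r$, and $\vartheta_n:=\int_{B(0,1)}(4\pi)^{-n/2}e^{-|z|^2/4}\,dz$. *)

theory Defs
  imports "HOL-Analysis.Analysis"
begin

definition locally_integrable :: "('a::euclidean_space \<Rightarrow> real) \<Rightarrow> bool" where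
  "locally_integrable f \<longleftrightarrow> (\<forall>K. compact K \<longrightarrow> f absolutely_integrable_on K)"

definition ess_inf_on :: "'a::euclidean_space set \<Rightarrow> ('a \<Rightarrow> real) \<Rightarrow> ereal" where
  "ess_inf_on B f = Sup {m::ereal. AE x in lebesgue. x \<in> B \<longrightarrow> m \<le> ereal (f x)}"

text \<open>The integrand \<open>f - ess inf\<close> is nonnegative almost everywhere on the ball, so truncating it
  to \<open>ennreal\<close> changes it on a null set only; it is \<open>\<infinity>\<close> if the essential infimum is \<open>-\<infinity>\<close>.\<close>

definition BLO_norm :: "('a::euclidean_space \<Rightarrow> real) \<Rightarrow> ennreal" where
  "BLO_norm f = (SUP (c, r) \<in> UNIV \<times> {0<..}.
     (\<integral>\<^sup>+x\<in>ball c r. e2ennreal (ereal (f x) - ess_inf_on (ball c r) f) \<partial>lebesgue)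
       / emeasure lebesgue (ball c r))"

definition BLO :: "('a::euclidean_space \<Rightarrow> real) set" where
  "BLO = {f. locally_integrable f \<and> BLO_norm f < \<infinity>}"

definition heat_kernel :: "real \<Rightarrow> real^'n \<Rightarrow> real" where
  "heat_kernel t z =
     (4 * pi * t) powr (- real CARD('n) / 2) * exp (- (norm z)\<^sup>2 / (4 * t))"

definition heat_mass :: "'n::finite itself \<Rightarrow> real" where
  "heat_mass _ = (LINT z : ball (0::real^'n) 1 | lebesgue.
     (4 * pi) powr (- real CARD('n) / 2) * exp (- (norm z)\<^sup>2 / 4))"

text \<open>On the second branch the essential infimum is finite: it is never \<open>\<infinity>\<close> for a real-valued
  function on a nonempty open ball.\<close>

definition heat_exp_integral :: "real \<Rightarrow> (real^'n \<Rightarrow> real) \<Rightarrow> real^'n \<Rightarrow> real \<Rightarrow> ennreal" where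
  "heat_exp_integral lam f x t =
     (let B = ball x (sqrt t); m = ess_inf_on B f in
      if m = - \<infinity> then \<infinity>
      else \<integral>\<^sup>+y\<in>B. ennreal (heat_kernel t (x - y) * exp (lam * (f y - real_of_ereal m))) \<partial>lebesgue)"

definition heat_exp_sup :: "real \<Rightarrow> (real^'n \<Rightarrow> real) \<Rightarrow> ennreal" where
  "heat_exp_sup lam f = (SUP (x, t) \<in> UNIV \<times> {0<..}.
     ennreal (1 / heat_mass TYPE('n)) * heat_exp_integral lam f x t)"

end

theory Submission
  imports Defs
begin

text \<open>The forward direction is a John--Nirenberg argument on balls. With \<open>L\<close> a dimensional multiple
  of the BLO norm, let \<open>E\<close> be the set where \<open>f\<close> exceeds its essential infimum on the threefold
  dilate of a ball \<open>B\<close> by more than \<open>L\<close>; by Markov's inequality \<open>E\<close> occupies a small fraction. Almost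
  every point of \<open>E \<inter> B\<close> is the centre of a ball that is at least half filled by \<open>E\<close> while its
  double is not filled by \<open>E\<close>, so that the essential infimum on all larger concentric balls has
  grown by at most \<open>L\<close>. Fivefold dilates of a disjoint subfamily cover, with total measure at most
  half of that of \<open>B\<close>. Hence the measure of \<open>{f > ess inf + k L}\<close> halves each time \<open>k\<close> increases by
  one, which gives exponential integrability; the heat kernel at time \<open>t\<close> is comparable to a
  constant on balls of radius \<open>\<surd>t\<close>. The converse is Jensen's inequality for the normalised heat
  kernel, whose density on the ball is at least \<open>e\<^sup>-\<^sup>1\<^sup>/\<^sup>4\<close> times the uniform one.\<close>

section \<open>Vitali selections and density\<close>

text \<open>Subadditivity is enough for the sets \<open>P i\<close>, which may overlap, while
  disjointness merges the measures of the \<open>Q i\<close> into one. Enumerating \<open>C\<close>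
  by naturals and padding with the empty set turns both into series. It serves two Vitali
  selections: disjoint balls in the density argument, pieces of \<open>E\<close> in the
  iteration.\<close>

lemma emeasure_UN_le_disjoint:
  fixes c :: ennreal
  assumes C: "countable C"
    and P: "\<And>i. i \<in> C \<Longrightarrow> P i \<in> sets M" and Q: "\<And>i. i \<in> C \<Longrightarrow> Q i \<in> sets M"
    and disj: "disjoint_family_on Q C"
    and le: "\<And>i. i \<in> C \<Longrightarrow> emeasure M (P i) \<le> c * emeasure M (Q i)"
  shows "emeasure M (\<Union>i\<in>C. P i) \<le> c * emeasure M (\<Union>i\<in>C. Q i)"
proof -
  define h where "h X n = (if n \<in> to_nat_on C ` C then X (from_nat_into C n) else {})"
    for X :: "'a \<Rightarrow> 'b set" and n
  have inC: "from_nat_into C n \<in> C" if "n \<in> to_nat_on C ` C" for n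
    using that C by auto
  have UN: "(\<Union>i\<in>C. X i) = (\<Union>n. h X n)" for X
    using C by (auto simp: h_def split: if_splits)
  have disj': "disjoint_family (h Q)"
    unfolding disjoint_family_on_def
  proof (intro ballI impI)
    fix m n :: nat assume "m \<noteq> n"
    show "h Q m \<inter> h Q n = {}"
    proof (cases "m \<in> to_nat_on C ` C \<and> n \<in> to_nat_on C ` C")
      case True
      then have "from_nat_into C m \<noteq> from_nat_into C n"
        using C \<open>m \<noteq> n\<close> by auto
      then show ?thesis
        using True disj inC by (simp add: h_def disjoint_family_on_def)
    qed (auto simp: h_def)
  qed
  have "emeasure M (\<Union>n. h P n) \<le> (\<Sum>n. emeasure M (h P n))"
    using P inC by (intro emeasure_subadditive_countably) (auto simp: h_def)
  also have "\<dots> \<le> (\<Sum>n. c * emeasure M (h Q n))"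
    using le inC by (intro suminf_le) (auto simp: h_def)
  also have "\<dots> = c * (\<Sum>n. emeasure M (h Q n))"
    by simp
  also have "(\<Sum>n. emeasure M (h Q n)) = emeasure M (\<Union>n. h Q n)"
    using Q inC by (intro suminf_emeasure disj') (auto simp: h_def)
  finally show ?thesis
    by (simp add: UN)
qed

lemma emeasure_lebesgue_ball_scale:
  fixes c d :: "'a::euclidean_space"
  assumes "r \<ge> 0" "k \<ge> 0"
  shows "emeasure lebesgue (ball c (k * r)) = ennreal (k ^ DIM('a)) * emeasure lebesgue (ball d r)"
  using assms by (simp add: emeasure_ball power_mult_distrib mult_ac flip: ennreal_mult)

text \<open>A one-sided substitute for the Lebesgue density theorem. Given an open \<open>U\<close>
  around \<open>Z\<close>, Vitali's theorem covers \<open>Z\<close> up to a null set by disjoint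
  balls inside \<open>U\<close>, and \<open>E\<close> fills at most half of each, so
  \<open>Z\<close> lies in a set of at most half the measure of \<open>U\<close>. Repeating this
  shrinks the open supersets geometrically.\<close>

lemma negligible_small_density:
  fixes E Z :: "'a::euclidean_space set"
  assumes E: "E \<in> sets lebesgue" and "Z \<subseteq> E" and bdd: "Z \<subseteq> ball a b"
    and R: "R > 0"
    and small: "\<And>x r. \<lbrakk>x \<in> Z; 0 < r; r \<le> R\<rbrakk> \<Longrightarrow>
      emeasure lebesgue (E \<inter> ball x r) \<le> ennreal (1/2) * emeasure lebesgue (ball x r)"
  shows "negligible Z"
proof -
  \<comment> \<open>The summand 1 keeps \<open>M\<close> positive even if the ball is empty, so that
    there is always room for an outer approximation.\<close>
  define M where "M = measure lebesgue (ball a b) + 1"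
  have M: "M > 0" unfolding M_def by (simp add: add_nonneg_pos)
  have "\<exists>U. open U \<and> Z \<subseteq> U \<and> emeasure lebesgue U \<le> ennreal ((3/4) ^ k * M)" for k
  proof (induction k)
    case 0
    have "emeasure lebesgue (ball a b) \<le> ennreal M"
      by (simp add: emeasure_eq_ennreal_measure M_def ennreal_leI fmeasurableD2)
    then show ?case using bdd by (intro exI[of _ "ball a b"]) auto
  next
    case (Suc k)
    then obtain U where U: "open U" "Z \<subseteq> U" "emeasure lebesgue U \<le> ennreal ((3/4) ^ k * M)"
      by blast
    define K where "K = {(x, r). x \<in> Z \<and> 0 < r \<and> r \<le> R \<and> ball x r \<subseteq> U}"
    have fine: "\<exists>i. i \<in> K \<and> x \<in> ball (fst i) (snd i) \<and> snd i < d" if x: "x \<in> Z" and d: "d > 0" for x d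
    proof -
      obtain e where e: "e > 0" "ball x e \<subseteq> U"
        using U x openE by blast
      define r where "r = min e (min R (d / 2))"
      have "r > 0" "r \<le> R" "r < d" "ball x r \<subseteq> ball x e"
        using e d R by (auto simp: r_def)
      then show ?thesis
        using e x by (intro exI[of _ "(x, r)"]) (auto simp: K_def)
    qed
    obtain C where C: "countable C" "C \<subseteq> K"
      and pw: "pairwise (\<lambda>i j. disjnt (ball (fst i) (snd i)) (ball (fst j) (snd j))) C"
      and neg: "negligible (Z - (\<Union>i\<in>C. ball (fst i) (snd i)))"
      by (rule Vitali_covering_theorem_balls[of Z K fst snd, OF fine])
    define N where "N = Z - (\<Union>i\<in>C. ball (fst i) (snd i))"
    define T where "T = (\<Union>i\<in>C. E \<inter> ball (fst i) (snd i))"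
    have T: "T \<in> sets lebesgue"
      unfolding T_def using C E by (intro sets.countable_UN') auto
    have N: "N \<in> null_sets lebesgue"
      using neg by (simp add: N_def negligible_iff_null_sets)
    have ZT: "Z \<subseteq> T \<union> N"
      using \<open>Z \<subseteq> E\<close> by (auto simp: T_def N_def)
    have "emeasure lebesgue T \<le> ennreal (1/2) * emeasure lebesgue (\<Union>i\<in>C. ball (fst i) (snd i))"
      unfolding T_def
    proof (rule emeasure_UN_le_disjoint)
      show "disjoint_family_on (\<lambda>i. ball (fst i) (snd i)) C"
        using pw by (auto simp: disjoint_family_on_def pairwise_def disjnt_def)
    qed (use C E small in \<open>auto simp: K_def\<close>)
    also have "\<dots> \<le> ennreal (1/2) * emeasure lebesgue U"
      using C U by (intro mult_left_mono emeasure_mono) (fastforce simp: K_def)+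
    also have "\<dots> \<le> ennreal (1/2) * ennreal ((3/4) ^ k * M)"
      using U by (intro mult_left_mono) auto
    also have "\<dots> = ennreal ((1/2) * ((3/4) ^ k * M))"
      using M by (intro ennreal_mult[symmetric]) auto
    finally have Tle: "emeasure lebesgue (T \<union> N) \<le> ennreal ((1/2) * ((3/4) ^ k * M))"
      using T N by (simp add: emeasure_Un_null_set)
    have pos: "(3/4) ^ k * M / 4 > 0" using M by simp
    have TN: "T \<union> N \<in> sets lebesgue" using T N by auto
    \<comment> \<open>The new superset must be open again for the next round; opening it up costs a
      further 1/4, whence the ratio 1/2 + 1/4 = 3/4.\<close>
    obtain V where V: "open V" "T \<union> N \<subseteq> V" "V - (T \<union> N) \<in> lmeasurable"
      "emeasure lebesgue (V - (T \<union> N)) < ennreal ((3/4) ^ k * M / 4)"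
      using sets_lebesgue_outer_open[OF TN pos] by blast
    have "emeasure lebesgue V = emeasure lebesgue (T \<union> N) + emeasure lebesgue (V - (T \<union> N))"
      using V TN by (subst plus_emeasure) (auto simp: Un_absorb1)
    also have "\<dots> \<le> ennreal ((1/2) * ((3/4) ^ k * M)) + ennreal ((3/4) ^ k * M / 4)"
      using Tle V by (intro add_mono) auto
    also have "\<dots> = ennreal ((3/4) ^ Suc k * M)"
      using M by (simp flip: ennreal_plus)
    finally show ?case
      using V ZT by blast
  qed
  then obtain U where U: "\<And>k. open (U k)" "\<And>k. Z \<subseteq> U k"
    "\<And>k. emeasure lebesgue (U k) \<le> ennreal ((3/4) ^ k * M)" by metis
  show ?thesis
    unfolding negligible_outer_le
  proof (intro allI impI)
    fix e :: real assume "e > 0"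
    then obtain k where k: "(3/4) ^ k < e / M"
      using M real_arch_pow_inv[of "e/M" "3/4"] by auto
    have "U k \<in> lmeasurable"
      using U(1)[of k] U(3)[of k] by (intro fmeasurableI) (auto simp: less_top[symmetric] top_unique)
    moreover have "measure lebesgue (U k) \<le> (3/4) ^ k * M"
      unfolding measure_def using U(3)[of k] M by (intro enn2real_leI) auto
    moreover have "(3/4) ^ k * M \<le> e"
      using k M by (simp add: less_divide_eq)
    ultimately show "\<exists>T. Z \<subseteq> T \<and> T \<in> lmeasurable \<and> measure lebesgue T \<le> e"
      using U(2)[of k] by (intro exI[of _ "U k"]) auto
  qed
qed

section \<open>Geometric decay by stopping balls\<close>

text \<open>Here \<open>m c r\<close> abstracts the essential infimum over a ball: the iteration
  uses only its monotonicity, the almost everywhere lower bound and the one-step estimate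
  \<open>exceed\<close>. In the constant \<open>4 * 15 ^ DIM('a)\<close>, the factor 3^d pays for
  tripling the ball, 5^d for the Vitali dilation, one 2 for balls only half filled by
  \<open>E\<close>, and the other 2 is the gain per step.\<close>

lemma emeasure_exceedance_geometric:
  fixes f :: "'a::euclidean_space \<Rightarrow> real" and m :: "'a \<Rightarrow> real \<Rightarrow> real"
  assumes f: "f \<in> borel_measurable lebesgue"
    and mono: "\<And>c r c' r'. \<lbrakk>r > 0; ball c r \<subseteq> ball c' r'\<rbrakk> \<Longrightarrow> m c' r' \<le> m c r"
    and lower: "\<And>c r. r > 0 \<Longrightarrow> AE x in lebesgue. x \<in> ball c r \<longrightarrow> m c r \<le> f x"
    and exceed: "\<And>c r. r > 0 \<Longrightarrow> emeasure lebesgue {x \<in> ball c r. f x > m c r + L} \<le>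
      ennreal (1 / (4 * 15 ^ DIM('a))) * emeasure lebesgue (ball c r)"
    and L: "L \<ge> 0" and "r > 0"
  shows "emeasure lebesgue {x \<in> ball c r. f x > m c r + real k * L} \<le>
    ennreal ((1/2) ^ k) * emeasure lebesgue (ball c r)"
  using \<open>r > 0\<close>
proof (induction k arbitrary: c r)
  case 0
  have "emeasure lebesgue {x \<in> ball c r. f x > m c r + real 0 * L} \<le> emeasure lebesgue (ball c r)"
    by (intro emeasure_mono) auto
  then show ?case by simp
next
  case (Suc k c R)
  note [measurable] = f
  have [measurable]: "ball a b \<in> sets lebesgue" for a :: 'a and b by auto
  have meas: "{x \<in> ball a b. f x > s} \<in> sets lebesgue" for a b s
  proof -
    have "{x \<in> ball a b. f x > s} = {x \<in> space lebesgue. x \<in> ball a b \<and> f x > s}" by auto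
    also have "\<dots> \<in> sets lebesgue" by measurable
    finally show ?thesis .
  qed
  \<comment> \<open>The tripled ball contains every \<open>ball x (2 * r)\<close> with
    \<open>x\<close> in \<open>ball c R\<close> and \<open>r \<le> R\<close>.\<close>
  define m0 where "m0 = m c (3 * R)"
  define E where "E = {x \<in> ball c (3 * R). f x > m0 + L}"
  have E: "E \<in> sets lebesgue" unfolding E_def by (rule meas)
  have m0: "m0 \<le> m c R"
    unfolding m0_def using Suc.prems by (intro mono) auto
  let ?B = "emeasure lebesgue (ball c R)"
  have "emeasure lebesgue E \<le>
      ennreal (1 / (4 * 15 ^ DIM('a))) * emeasure lebesgue (ball c (3 * R))"
    unfolding E_def m0_def using Suc.prems by (intro exceed) auto
  also have "emeasure lebesgue (ball c (3 * R)) = ennreal (3 ^ DIM('a)) * ?B"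
    using Suc.prems by (intro emeasure_lebesgue_ball_scale) auto
  also have "ennreal (1 / (4 * 15 ^ DIM('a))) * (ennreal (3 ^ DIM('a)) * ?B) =
      ennreal (1 / (4 * 15 ^ DIM('a)) * 3 ^ DIM('a)) * ?B"
    by (subst ennreal_mult) (auto simp: mult.assoc)
  also have "1 / (4 * 15 ^ DIM('a)) * 3 ^ DIM('a) = (1 / (4 * 5 ^ DIM('a)) :: real)"
    using power_mult_distrib[of "3::real" 5 "DIM('a)"] by simp
  finally have Ele: "emeasure lebesgue E \<le> ennreal (1 / (4 * 5 ^ DIM('a))) * ?B" .
  \<comment> \<open>Consequently \<open>E\<close> cannot fill any ball of radius \<open>R\<close>;
    this handles stopping radii whose double exceeds \<open>R\<close>.\<close>
  have "ennreal (1 / (4 * 5 ^ DIM('a))) * ?B < ?B"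
  proof -
    define v where "v = unit_ball_vol (real DIM('a)) * R ^ DIM('a)"
    have v: "v > 0" "?B = ennreal v"
      using Suc.prems by (auto simp: v_def emeasure_ball)
    have "1 \<le> (5::real) ^ DIM('a)"
      by simp
    then have "1 < 4 * (5::real) ^ DIM('a)"
      by linarith
    then have "1 / (4 * 5 ^ DIM('a)) < (1::real)"
      by simp
    then have "1 / (4 * 5 ^ DIM('a)) * v < 1 * v"
      using v by (intro mult_strict_right_mono)
    then show ?thesis
      using v by (simp add: ennreal_lessI flip: ennreal_mult)
  qed
  with Ele have Eless: "emeasure lebesgue E < ?B" by simp

  \<comment> \<open>Otherwise monotonicity gives an infimum above \<open>m0 + L\<close> already on
    the ball of radius \<open>2 * r\<close>, so almost all of that ball lies in \<open>E\<close>.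
    The factor 5 anticipates the Vitali dilation.\<close>
  have low: "m x (5 * r) \<le> m0 + L"
    if x: "ball x (2 * r) \<subseteq> ball c (3 * R)" and r: "r > 0"
      and dens: "emeasure lebesgue (E \<inter> ball x (2 * r)) < emeasure lebesgue (ball x (2 * r))" for x r
  proof (rule ccontr)
    assume *: "\<not> m x (5 * r) \<le> m0 + L"
    have "m x (5 * r) \<le> m x (2 * r)" using r by (intro mono) auto
    with * have "m0 + L < m x (2 * r)" by linarith
    moreover have "AE y in lebesgue. y \<in> ball x (2 * r) \<longrightarrow> m x (2 * r) \<le> f y"
      using lower r by simp
    ultimately have "AE y in lebesgue. y \<in> ball x (2 * r) \<longrightarrow> y \<in> E \<inter> ball x (2 * r)"
      using x by (auto simp: E_def elim!: eventually_mono)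
    then have "emeasure lebesgue (ball x (2 * r)) \<le> emeasure lebesgue (E \<inter> ball x (2 * r))"
      using E by (intro emeasure_mono_AE) auto
    with dens show False by simp
  qed

  \<comment> \<open>The stopping balls: at least half filled by \<open>E\<close>, yet with the
    infimum on the fivefold dilate still controlled.\<close>
  define K where "K = {(x, r). x \<in> ball c R \<and> 0 < r \<and> r \<le> R \<and> m x (5 * r) \<le> m0 + L \<and>
    emeasure lebesgue (ball x r) \<le> 2 * emeasure lebesgue (E \<inter> ball x r)}"
  define Z where "Z = E \<inter> ball c R - (\<Union>i\<in>K. ball (fst i) (snd i))"
  have negZ: "negligible Z"
  proof (rule negligible_small_density[OF E])
    fix x s assume x: "x \<in> Z" and s: "0 < s" "s \<le> R"
    show "emeasure lebesgue (E \<inter> ball x s) \<le> ennreal (1/2) * emeasure lebesgue (ball x s)"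
    proof (rule ccontr)
      assume neg: "\<not> ?thesis"
      define S where "S = {r. 0 < r \<and> r \<le> R \<and>
        emeasure lebesgue (ball x r) \<le> 2 * emeasure lebesgue (E \<inter> ball x r)}"
      have half: "2 * ennreal (1/2) = 1"
        using ennreal_mult[of 2 "1/2"] by simp
      have "emeasure lebesgue (ball x s) = 2 * (ennreal (1/2) * emeasure lebesgue (ball x s))"
        using half by (simp only: mult.assoc[symmetric] mult_1)
      also have "\<dots> \<le> 2 * emeasure lebesgue (E \<inter> ball x s)"
        using neg by (intro mult_left_mono) auto
      finally have "s \<in> S"
        using s by (simp add: S_def)
      have bdd: "bdd_above S" by (auto simp: S_def bdd_above_def)
      \<comment> \<open>The supremum of the half-filled radii need not be attained; a radius
        \<open>r\<close> beyond half of it suffices, since then \<open>2 * r\<close> is no longer in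
        \<open>S\<close>.\<close>
      have "Sup S / 2 < Sup S"
        using \<open>s \<in> S\<close> s cSup_upper[OF \<open>s \<in> S\<close> bdd] by simp
      then obtain r where r: "r \<in> S" "Sup S / 2 < r"
        using less_cSupD[of S] \<open>s \<in> S\<close> by blast
      have xB: "x \<in> ball c R" using x by (simp add: Z_def)
      have r0: "0 < r" "r \<le> R" using r by (auto simp: S_def)
      have dens: "emeasure lebesgue (E \<inter> ball x (2 * r)) < emeasure lebesgue (ball x (2 * r))"
      proof (cases "2 * r \<le> R")
        case True
        have "2 * r \<notin> S" using r(2) cSup_upper[OF _ bdd, of "2 * r"] by auto
        then have "2 * emeasure lebesgue (E \<inter> ball x (2 * r)) < emeasure lebesgue (ball x (2 * r))"
          using True r0 by (auto simp: S_def)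
        moreover have "emeasure lebesgue (E \<inter> ball x (2 * r)) \<le> 2 * emeasure lebesgue (E \<inter> ball x (2 * r))"
          by (subst mult_2) (rule add_increasing[OF zero_le order_refl])
        ultimately show ?thesis by simp
      next
        case False
        \<comment> \<open>Here \<open>2 * r\<close> leaves \<open>S\<close> merely by its size, so
          the density bound comes instead from \<open>E\<close> being smaller than a ball of radius
          \<open>R\<close>.\<close>
        have "emeasure lebesgue (E \<inter> ball x (2 * r)) \<le> emeasure lebesgue E"
          using E by (intro emeasure_mono) auto
        also have "\<dots> < ?B" by fact
        also have "?B = emeasure lebesgue (ball x R)"
          using Suc.prems by (simp add: emeasure_ball)
        also have "\<dots> \<le> emeasure lebesgue (ball x (2 * r))"
          using False by (intro emeasure_mono) auto
        finally show ?thesis .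
      qed
      have "ball x (2 * r) \<subseteq> ball c (3 * R)"
        using xB r0 by (simp add: ball_subset_ball_iff dist_commute)
      then have "(x, r) \<in> K"
        using low[of x r] dens r r0 xB by (auto simp: K_def S_def)
      then have "x \<in> (\<Union>i\<in>K. ball (fst i) (snd i))" using r0 by force
      then show False using x by (simp add: Z_def)
    qed
  qed (use Suc.prems in \<open>auto simp: Z_def\<close>)

  have Kr: "0 < snd i \<and> snd i \<le> R" if "i \<in> K" for i
    using that by (auto simp: K_def)
  obtain C where C: "countable C" "C \<subseteq> K"
    and pw: "pairwise (\<lambda>i j. disjnt (ball (fst i) (snd i)) (ball (fst j) (snd j))) C"
    and cov: "(\<Union>i\<in>K. ball (fst i) (snd i)) \<subseteq> (\<Union>i\<in>C. ball (fst i) (5 * snd i))"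
    by (rule Vitali_covering_lemma_balls[OF subset_refl Kr, where a = fst])
  define P where "P i = {x \<in> ball (fst i) (5 * snd i). f x > m (fst i) (5 * snd i) + real k * L}"
    for i :: "'a \<times> real"
  \<comment> \<open>The induction hypothesis on the dilated ball gives \<open>(1/2) ^ k\<close>,
    undoing the dilation gives 5^d, and half-filling gives 2.\<close>
  have Ple: "emeasure lebesgue (P i) \<le>
      ennreal ((1/2) ^ k * (5 ^ DIM('a) * 2)) * emeasure lebesgue (E \<inter> ball (fst i) (snd i))"
    if "i \<in> C" for i
  proof -
    obtain x r where i: "i = (x, r)" by (cases i)
    have r: "0 < r" "emeasure lebesgue (ball x r) \<le> 2 * emeasure lebesgue (E \<inter> ball x r)"
      using that C i by (auto simp: K_def)
    have "emeasure lebesgue (P i) \<le> ennreal ((1/2) ^ k) * emeasure lebesgue (ball x (5 * r))"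
      using Suc.IH[of "5 * r" x] r by (simp add: P_def i)
    also have "\<dots> = ennreal ((1/2) ^ k) * (ennreal (5 ^ DIM('a)) * emeasure lebesgue (ball x r))"
      using r by (subst emeasure_lebesgue_ball_scale[of r 5 x x]) auto
    also have "\<dots> \<le> ennreal ((1/2) ^ k) * (ennreal (5 ^ DIM('a)) * (2 * emeasure lebesgue (E \<inter> ball x r)))"
      using r by (intro mult_left_mono) auto
    also have "\<dots> = ennreal ((1/2) ^ k * (5 ^ DIM('a) * 2)) * emeasure lebesgue (E \<inter> ball x r)"
      by (simp add: ennreal_mult mult_ac)
    finally show ?thesis by (simp add: i)
  qed
  let ?U = "\<Union>i\<in>C. P i"
  have Pm: "P i \<in> sets lebesgue" for i unfolding P_def by (rule meas)
  have sub: "{x \<in> ball c R. f x > m c R + real (Suc k) * L} \<subseteq> ?U \<union> Z"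
  proof
    fix x assume x: "x \<in> {x \<in> ball c R. f x > m c R + real (Suc k) * L}"
    \<comment> \<open>One of the \<open>k + 1\<close> levels is spent on passing from
      \<open>m0\<close> to \<open>m0 + L\<close>, which bounds the infimum on the dilated stopping
      balls; \<open>k\<close> levels remain for the induction hypothesis.\<close>
    have "m0 + L + real k * L < f x"
      using x m0 by (simp add: algebra_simps)
    moreover have "real k * L \<ge> 0" using L by simp
    ultimately have fx: "m0 + L + real k * L < f x" "f x > m0 + L" by linarith+
    have xE: "x \<in> E" using fx x Suc.prems by (auto simp: E_def)
    show "x \<in> ?U \<union> Z"
    proof (cases "x \<in> Z")
      case False
      then have "x \<in> (\<Union>i\<in>K. ball (fst i) (snd i))" using xE x by (auto simp: Z_def)
      then obtain i where i: "i \<in> C" "x \<in> ball (fst i) (5 * snd i)" using cov by blast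
      have "m (fst i) (5 * snd i) \<le> m0 + L" using i C by (auto simp: K_def)
      then have "x \<in> P i" using i fx by (auto simp: P_def)
      then show ?thesis using i by blast
    qed auto
  qed
  have Um: "?U \<in> sets lebesgue"
    using C Pm by (intro sets.countable_UN') auto
  have "emeasure lebesgue {x \<in> ball c R. f x > m c R + real (Suc k) * L} \<le> emeasure lebesgue (?U \<union> Z)"
    using sub Um negZ
    by (intro emeasure_mono) (auto simp: negligible_iff_null_sets)
  also have "\<dots> = emeasure lebesgue ?U"
    using Um negZ by (simp add: emeasure_Un_null_set negligible_iff_null_sets)
  also have "\<dots> \<le> ennreal ((1/2) ^ k * (5 ^ DIM('a) * 2)) *
      emeasure lebesgue (\<Union>i\<in>C. E \<inter> ball (fst i) (snd i))"
  proof (rule emeasure_UN_le_disjoint)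
    show "disjoint_family_on (\<lambda>i. E \<inter> ball (fst i) (snd i)) C"
      using pw by (fastforce simp: disjoint_family_on_def pairwise_def disjnt_def)
  qed (use C E Pm Ple in auto)
  also have "\<dots> \<le> ennreal ((1/2) ^ k * (5 ^ DIM('a) * 2)) * emeasure lebesgue E"
    using E by (intro mult_left_mono emeasure_mono) auto
  also have "\<dots> \<le> ennreal ((1/2) ^ k * (5 ^ DIM('a) * 2)) * (ennreal (1 / (4 * 5 ^ DIM('a))) * ?B)"
    by (intro mult_left_mono Ele) auto
  also have "\<dots> = ennreal ((1/2) ^ k * (5 ^ DIM('a) * 2) * (1 / (4 * 5 ^ DIM('a)))) * ?B"
    by (subst ennreal_mult[of _ "1 / (4 * 5 ^ DIM('a))"]) (auto simp: mult.assoc)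
  \<comment> \<open>The dimensional factors cancel and 2/4 supplies the next halving.\<close>
  also have "(1/2) ^ k * (5 ^ DIM('a) * 2) * (1 / (4 * 5 ^ DIM('a))) = ((1/2) ^ Suc k :: real)"
    by simp
  finally show ?case .
qed

section \<open>Essential infima and BLO functions\<close>

lemma ess_inf_on_mono: "B \<subseteq> B' \<Longrightarrow> ess_inf_on B' f \<le> ess_inf_on B f"
  unfolding ess_inf_on_def by (intro Sup_subset_mono) (auto elim!: eventually_mono)

text \<open>The supremum of the almost everywhere lower bounds is reached along a sequence of them,
  and countably many exceptional null sets still form a null set. Hence the supremum is itself such
  a lower bound.\<close>

lemma AE_ess_inf_on_le:
  "AE x in lebesgue. x \<in> B \<longrightarrow> ess_inf_on B f \<le> ereal (f x)"
proof -
  let ?S = "{m::ereal. AE x in lebesgue. x \<in> B \<longrightarrow> m \<le> ereal (f x)}"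
  have "- \<infinity> \<in> ?S" by simp
  then obtain g :: "nat \<Rightarrow> ereal" where g: "range g \<subseteq> ?S" "Sup ?S = (SUP i. g i)"
    using Sup_countable_SUP[of ?S] by blast
  have "AE x in lebesgue. \<forall>i. x \<in> B \<longrightarrow> g i \<le> ereal (f x)"
    using g(1) by (subst AE_all_countable) auto
  then show ?thesis
    unfolding ess_inf_on_def g(2) by eventually_elim (auto intro: SUP_least)
qed

lemma ess_inf_on_neq_infinity:
  assumes "B \<in> sets lebesgue" "emeasure lebesgue B \<noteq> 0"
  shows "ess_inf_on B f \<noteq> \<infinity>"
proof
  assume "ess_inf_on B f = \<infinity>"
  then have "AE x in lebesgue. x \<notin> B"
    using AE_ess_inf_on_le[of B f] by (auto elim!: eventually_mono)
  then show False
    using assms AE_iff_null_sets[of B lebesgue] by auto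
qed

lemma locally_integrable_imp_measurable:
  fixes f :: "'a::euclidean_space \<Rightarrow> real"
  assumes "locally_integrable f"
  shows "f \<in> borel_measurable lebesgue"
proof (rule borel_measurable_LIMSEQ_real)
  show "(\<lambda>x. indicator (cball 0 (real i)) x *\<^sub>R f x) \<in> borel_measurable lebesgue" for i
    using assms compact_cball[of "0::'a" "real i"]
    unfolding locally_integrable_def set_integrable_def by (blast intro: borel_measurable_integrable)
  show "(\<lambda>i. indicator (cball 0 (real i)) x *\<^sub>R f x) \<longlonglongrightarrow> f x" for x :: 'a
  proof (rule tendsto_eventually)
    obtain n :: nat where n: "norm x \<le> real n"
      using real_arch_simple by blast
    show "\<forall>\<^sub>F i in sequentially. indicator (cball 0 (real i)) x *\<^sub>R f x = f x"
      using eventually_ge_at_top[of n]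
      by eventually_elim (use n in \<open>auto simp: indicator_def\<close>)
  qed
qed

lemma emeasure_lebesgue_ball_real:
  fixes c :: "'a::euclidean_space"
  assumes "r > 0"
  obtains v where "v > 0" "emeasure lebesgue (ball c r) = ennreal v"
  using assms by (intro that[of "unit_ball_vol (real DIM('a)) * r ^ DIM('a)"]) (auto simp: emeasure_ball)

lemma nn_integral_oscillation_le_BLO_norm:
  assumes r: "r > 0"
  shows "(\<integral>\<^sup>+x\<in>ball c r. e2ennreal (ereal (f x) - ess_inf_on (ball c r) f) \<partial>lebesgue) \<le>
    BLO_norm f * emeasure lebesgue (ball c r)" (is "?I \<le> _")
proof -
  obtain v where v: "v > 0" "emeasure lebesgue (ball c r) = ennreal v"
    using emeasure_lebesgue_ball_real[OF r] .
  have "?I / ennreal v \<le> BLO_norm f"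
    unfolding BLO_norm_def v(2)[symmetric] using r by (intro SUP_upper2[of "(c, r)"]) auto
  then have "?I / ennreal v * ennreal v \<le> BLO_norm f * ennreal v"
    by (intro mult_right_mono) auto
  also have "?I / ennreal v * ennreal v = ?I"
    using v by (simp add: ennreal_divide_times)
  finally show ?thesis by (simp only: v)
qed

text \<open>An infimum of \<open>- \<infinity>\<close> would make the oscillation infinite
  throughout a ball of positive measure, against the finite norm. This justifies passing to
  \<open>real_of_ereal\<close> for BLO functions.\<close>

lemma BLO_ess_inf_finite:
  assumes "f \<in> BLO" "r > 0"
  shows "\<bar>ess_inf_on (ball c r) f\<bar> \<noteq> \<infinity>"
proof -
  obtain v where v: "v > 0" "emeasure lebesgue (ball c r) = ennreal v"
    using emeasure_lebesgue_ball_real[OF assms(2)] .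
  have "ess_inf_on (ball c r) f \<noteq> \<infinity>"
    using v by (intro ess_inf_on_neq_infinity) auto
  moreover have "ess_inf_on (ball c r) f \<noteq> - \<infinity>"
  proof
    assume *: "ess_inf_on (ball c r) f = - \<infinity>"
    have "(\<integral>\<^sup>+x. \<infinity> * indicator (ball c r) x \<partial>lebesgue) \<le> BLO_norm f * emeasure lebesgue (ball c r)"
      using nn_integral_oscillation_le_BLO_norm[OF assms(2), of f c] by (simp add: *)
    then have "\<infinity> * ennreal v \<le> BLO_norm f * ennreal v"
      using v by (subst (asm) nn_integral_cmult_indicator) auto
    moreover have "BLO_norm f * ennreal v < \<infinity>"
      using assms by (simp add: BLO_def ennreal_mult_less_top)
    ultimately show False
      using v by (simp add: ennreal_top_mult)
  qed
  ultimately show ?thesis by auto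
qed

text \<open>Markov's inequality for the oscillation integral; it supplies the hypothesis
  \<open>exceed\<close> of the geometric decay.\<close>

lemma BLO_exceedance:
  fixes f :: "'a::euclidean_space \<Rightarrow> real"
  assumes f: "f \<in> BLO" and r: "r > 0" and L: "L > 0"
  shows "emeasure lebesgue {x \<in> ball c r. f x > real_of_ereal (ess_inf_on (ball c r) f) + L} \<le>
    ennreal (enn2real (BLO_norm f) / L) * emeasure lebesgue (ball c r)"
proof -
  define m where "m = real_of_ereal (ess_inf_on (ball c r) f)"
  have m: "ess_inf_on (ball c r) f = ereal m"
    using BLO_ess_inf_finite[OF f r, of c] by (simp add: m_def ereal_real)
  have [measurable]: "f \<in> borel_measurable lebesgue"
    using f by (auto simp: BLO_def intro: locally_integrable_imp_measurable)
  have [measurable]: "ball c r \<in> sets lebesgue" by simp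
  have N: "BLO_norm f = ennreal (enn2real (BLO_norm f))"
    using f by (simp add: BLO_def)
  let ?u = "\<lambda>x. ennreal (f x - m)"
  have um: "(\<lambda>x. ?u x * indicator (ball c r) x) \<in> borel_measurable lebesgue"
    by measurable
  have "emeasure lebesgue {x \<in> ball c r. f x > m + L} \<le>
      emeasure lebesgue {x \<in> ball c r. 1 \<le> ennreal (1 / L) * ?u x}"
  proof (rule emeasure_mono)
    show "{x \<in> ball c r. f x > m + L} \<subseteq> {x \<in> ball c r. 1 \<le> ennreal (1 / L) * ?u x}"
      using L by (auto simp: field_simps simp flip: ennreal_mult' ennreal_1)
    have "{x \<in> ball c r. 1 \<le> ennreal (1 / L) * ?u x} =
      {x \<in> space lebesgue. x \<in> ball c r \<and> 1 \<le> ennreal (1 / L) * ?u x}" by auto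
    also have "\<dots> \<in> sets lebesgue" by measurable
    finally show "{x \<in> ball c r. 1 \<le> ennreal (1 / L) * ?u x} \<in> sets lebesgue" .
  qed
  also have "\<dots> \<le> ennreal (1 / L) * (\<integral>\<^sup>+x\<in>ball c r. ?u x \<partial>lebesgue)"
    using um by (intro nn_integral_Markov_inequality) auto
  also have "(\<integral>\<^sup>+x\<in>ball c r. ?u x \<partial>lebesgue) \<le> BLO_norm f * emeasure lebesgue (ball c r)"
    using nn_integral_oscillation_le_BLO_norm[OF r, of f c] unfolding m by simp
  finally have "emeasure lebesgue {x \<in> ball c r. f x > m + L} \<le>
      ennreal (1 / L) * (BLO_norm f * emeasure lebesgue (ball c r))"
    by (simp add: mult_left_mono)
  also have "\<dots> = ennreal (enn2real (BLO_norm f) / L) * emeasure lebesgue (ball c r)"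
    using L by (subst N) (simp add: ennreal_mult''[symmetric] mult.assoc[symmetric] divide_ennreal)
  finally show ?thesis by (simp only: m_def)
qed

section \<open>Exponential integrability\<close>

text \<open>With rate \<open>ln (4/3) / L\<close> the exponential grows by 4/3 per level while the
  measure halves, a convergent ratio 2/3. The levels contribute (4/3) * 3 = 4 and the points with
  \<open>f x \<le> m\<close> contribute 1, which gives the constant 5.\<close>

lemma nn_integral_exp_le_of_geometric_exceedance:
  fixes f :: "'a \<Rightarrow> real"
  assumes [measurable]: "f \<in> borel_measurable M" "B \<in> sets M" and L: "L > 0"
    and tail: "\<And>k::nat. emeasure M {x \<in> B. f x > m + real k * L} \<le> ennreal ((1/2) ^ k) * emeasure M B"
  shows "(\<integral>\<^sup>+x\<in>B. ennreal (exp (ln (4/3) / L * (f x - m))) \<partial>M) \<le> 5 * emeasure M B"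
proof -
  define S where "S k = {x \<in> B. f x > m + real k * L}" for k :: nat
  have S [measurable]: "S k \<in> sets M" for k
  proof -
    have "S k = {x \<in> space M. x \<in> B \<and> f x > m + real k * L}"
      using sets.sets_into_space[OF assms(2)] by (auto simp: S_def)
    also have "\<dots> \<in> sets M" by measurable
    finally show ?thesis .
  qed
  have ptw: "ennreal (exp (ln (4/3) / L * (f x - m))) * indicator B x \<le>
      indicator B x + (\<Sum>k. ennreal ((4/3) ^ Suc k) * indicator (S k) x)" (is "?l \<le> _ + ?s") for x
  proof (cases "x \<in> B")
    case B: True
    show ?thesis
    proof (cases "f x \<le> m")
      case True
      then have "exp (ln (4/3) / L * (f x - m)) \<le> 1"
        using L by (simp add: mult_nonneg_nonpos divide_nonpos_pos)
      then have "?l \<le> 1" using B by (simp add: ennreal_le_1)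
      also have "1 \<le> indicator B x + ?s" using B by simp
      finally show ?thesis .
    next
      case False
      \<comment> \<open>The level sets are strict, so \<open>j\<close> is the largest integer
        strictly below \<open>(f x - m) / L\<close>; the exponential is then bounded at level
        \<open>Suc j\<close>, not \<open>j\<close>.\<close>
      define j where "j = nat (\<lceil>(f x - m) / L\<rceil> - 1)"
      have pos: "(f x - m) / L > 0" using False L by simp
      have j: "real j < (f x - m) / L" "(f x - m) / L \<le> real j + 1"
        using pos unfolding j_def by linarith+
      then have xS: "x \<in> S j"
        using B L by (simp add: S_def field_simps)
      have "exp (ln (4/3) / L * (f x - m)) = exp (ln (4/3) * ((f x - m) / L))" by simp
      also have "\<dots> \<le> exp (ln (4/3) * real (Suc j))"
        using j by (intro exp_le_cancel_iff[THEN iffD2] mult_left_mono) auto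
      also have "\<dots> = (4/3) ^ Suc j"
        by (simp only: exp_of_nat2_mult) simp
      finally have "?l \<le> ennreal ((4/3) ^ Suc j) * indicator (S j) x"
        using xS by (auto simp: indicator_def intro!: ennreal_leI)
      also have "\<dots> \<le> ?s"
        using sum_le_suminf[of "\<lambda>k. ennreal ((4/3) ^ Suc k) * indicator (S k) x" "{j}"]
        by (simp del: power_Suc sum_mult_indicator)
      also have "\<dots> \<le> indicator B x + ?s" by simp
      finally show ?thesis .
    qed
  qed simp
  have "(\<integral>\<^sup>+x\<in>B. ennreal (exp (ln (4/3) / L * (f x - m))) \<partial>M) \<le>
      (\<integral>\<^sup>+x. indicator B x + (\<Sum>k. ennreal ((4/3) ^ Suc k) * indicator (S k) x) \<partial>M)"
    using ptw by (intro nn_integral_mono)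
  also have "\<dots> = emeasure M B + (\<Sum>k. \<integral>\<^sup>+x. ennreal ((4/3) ^ Suc k) * indicator (S k) x \<partial>M)"
    by (subst nn_integral_add, measurable, subst nn_integral_suminf) auto
  also have "(\<Sum>k. \<integral>\<^sup>+x. ennreal ((4/3) ^ Suc k) * indicator (S k) x \<partial>M) =
      (\<Sum>k. ennreal ((4/3) ^ Suc k) * emeasure M (S k))"
    by (intro suminf_cong nn_integral_cmult_indicator S)
  also have "\<dots> \<le> (\<Sum>k. ennreal (4/3 * (2/3) ^ k) * emeasure M B)"
  proof (intro suminf_le)
    fix k
    have "ennreal ((4/3) ^ Suc k) * emeasure M (S k) \<le>
        ennreal ((4/3) ^ Suc k) * (ennreal ((1/2) ^ k) * emeasure M B)"
      unfolding S_def by (intro mult_left_mono tail) simp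
    also have "\<dots> = ennreal ((4/3) ^ Suc k * (1/2) ^ k) * emeasure M B"
      by (subst ennreal_mult[of _ "(1/2) ^ k"]) (auto simp: mult.assoc)
    also have "(4/3) ^ Suc k * (1/2) ^ k = (4/3 * (2/3) ^ k :: real)"
      using power_mult_distrib[of "4/3::real" "1/2" k] by simp
    finally show "ennreal ((4/3) ^ Suc k) * emeasure M (S k) \<le> ennreal (4/3 * (2/3) ^ k) * emeasure M B" .
  qed auto
  also have "\<dots> = (\<Sum>k. ennreal (4/3 * (2/3) ^ k)) * emeasure M B"
    by simp
  also have "(\<Sum>k. ennreal (4/3 * (2/3) ^ k)) = ennreal 4"
    using sums_mult[OF geometric_sums[of "2/3::real"], of "4/3"]
    by (intro suminf_ennreal_eq) auto
  also have "emeasure M B + ennreal 4 * emeasure M B = 5 * emeasure M B"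
  proof -
    have "(5::ennreal) = 1 + 4" by simp
    then show ?thesis by (simp only: distrib_right) simp
  qed
  finally show ?thesis by (simp add: add_left_mono)
qed

lemma BLO_exp_integral_le:
  fixes f :: "'a::euclidean_space \<Rightarrow> real"
  assumes f: "f \<in> BLO" and r: "r > 0"
  shows "(\<integral>\<^sup>+x\<in>ball c r. ennreal (exp (ln (4/3) / (4 * 15 ^ DIM('a)) / enn2real (BLO_norm f) *
      (f x - real_of_ereal (ess_inf_on (ball c r) f)))) \<partial>lebesgue) \<le> 5 * emeasure lebesgue (ball c r)"
proof (cases "enn2real (BLO_norm f) = 0")
  case True
  \<comment> \<open>Division by zero yields 0, so the exponential is identically 1.\<close>
  have "emeasure lebesgue (ball c r) \<le> 5 * emeasure lebesgue (ball c r)"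
    using mult_right_mono[of 1 "5::ennreal" "emeasure lebesgue (ball c r)"] by simp
  with True show ?thesis by simp
next
  case False
  define N where "N = enn2real (BLO_norm f)"
  \<comment> \<open>Chosen so that \<open>N / L\<close> is exactly the fraction required for the
    geometric decay.\<close>
  define L where "L = 4 * 15 ^ DIM('a) * N"
  define m where "m a s = real_of_ereal (ess_inf_on (ball a s) f)" for a s
  have N: "N > 0" using False by (simp add: N_def less_le)
  then have L: "L > 0" by (simp add: L_def)
  have meas: "f \<in> borel_measurable lebesgue"
    using f by (auto simp: BLO_def intro: locally_integrable_imp_measurable)
  have m: "ess_inf_on (ball a s) f = ereal (m a s)" if "s > 0" for a s
    using BLO_ess_inf_finite[OF f that, of a] by (simp add: m_def ereal_real)
  have "(\<integral>\<^sup>+x\<in>ball c r. ennreal (exp (ln (4/3) / L * (f x - m c r))) \<partial>lebesgue) \<le>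
      5 * emeasure lebesgue (ball c r)"
  proof (rule nn_integral_exp_le_of_geometric_exceedance[OF meas _ L])
    show "emeasure lebesgue {x \<in> ball c r. m c r + real k * L < f x} \<le>
        ennreal ((1/2) ^ k) * emeasure lebesgue (ball c r)" for k
    proof (rule emeasure_exceedance_geometric[OF meas])
      show "m c' r' \<le> m c r" if "r > 0" "ball c r \<subseteq> ball c' r'" for c c' r r'
      proof -
        have "r' > 0" using that by (metis ball_eq_empty not_less subset_empty)
        then show ?thesis
          using ess_inf_on_mono[OF that(2), of f] that by (simp add: m)
      qed
      show "AE x in lebesgue. x \<in> ball c r \<longrightarrow> m c r \<le> f x" if "r > 0" for c r
        using AE_ess_inf_on_le[of "ball c r" f] that by (simp add: m)
      show "emeasure lebesgue {x \<in> ball c r. m c r + L < f x} \<le>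
          ennreal (1 / (4 * 15 ^ DIM('a))) * emeasure lebesgue (ball c r)" if "r > 0" for c r
        using BLO_exceedance[OF f that L, of c] N by (simp add: m_def L_def flip: N_def)
    qed (use L r in auto)
  qed simp
  then show ?thesis
    by (simp add: L_def m_def N_def)
qed

section \<open>The heat kernel on balls of radius \<open>sqrt t\<close>\<close>

text \<open>For \<open>t > 0\<close> this is the maximum of the heat kernel, attained at its
  centre.\<close>

definition heat_prefactor :: "'n::finite itself \<Rightarrow> real \<Rightarrow> real" where
  "heat_prefactor _ t = (4 * pi * t) powr (- real CARD('n) / 2)"

lemma heat_prefactor_pos: "t > 0 \<Longrightarrow> heat_prefactor TYPE('n::finite) t > 0"
  by (simp add: heat_prefactor_def)

text \<open>Parabolic scaling: the factor t^(-n/2) cancels the volume scaling of a ball of radius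
  \<open>sqrt t\<close>.\<close>

lemma heat_prefactor_sqrt:
  assumes "t > 0"
  shows "heat_prefactor TYPE('n::finite) t * sqrt t ^ CARD('n) = heat_prefactor TYPE('n) 1"
proof -
  have "sqrt t ^ CARD('n) = t powr (real CARD('n) / 2)"
    using assms by (simp add: powr_half_sqrt[symmetric] powr_powr flip: powr_realpow)
  then show ?thesis
    using assms by (simp add: heat_prefactor_def powr_mult powr_minus field_simps)
qed

text \<open>On the ball the squared distance is at most \<open>t\<close>, so the exponent lies
  between -1/4 and 0. This is the source of e^(1/4) in both implications.\<close>

lemma heat_kernel_bounds:
  fixes x y :: "real^'n"
  assumes "t > 0" "y \<in> ball x (sqrt t)"
  shows "exp (-1/4) * heat_prefactor TYPE('n) t \<le> heat_kernel t (x - y)"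
    and "heat_kernel t (x - y) \<le> heat_prefactor TYPE('n) t"
proof -
  have "norm (x - y) \<le> sqrt t" using assms by (simp add: dist_norm)
  then have "(norm (x - y))\<^sup>2 \<le> (sqrt t)\<^sup>2" by (intro power_mono) auto
  then have "- 1 / 4 \<le> - (norm (x - y))\<^sup>2 / (4 * t)"
    using assms by (simp add: field_simps)
  then show "exp (-1/4) * heat_prefactor TYPE('n) t \<le> heat_kernel t (x - y)"
    unfolding heat_kernel_def heat_prefactor_def
    by (subst mult.commute, intro mult_left_mono) auto
  have "exp (- (norm (x - y))\<^sup>2 / (4 * t)) \<le> 1" using assms by simp
  then show "heat_kernel t (x - y) \<le> heat_prefactor TYPE('n) t"
    unfolding heat_kernel_def heat_prefactor_def by (intro mult_left_le) auto
qed

lemma heat_kernel_measurable [measurable]: "heat_kernel t \<in> borel_measurable borel"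
  unfolding heat_kernel_def by measurable

text \<open>Transfers the mass from a Bochner integral over \<open>lebesgue\<close> to a nonnegative
  integral over \<open>lborel\<close>, where affine substitution is carried out; the bounds
  integrate those for the kernel at time 1.\<close>

lemma nn_integral_heat_kernel_unit_ball:
  "(\<integral>\<^sup>+z\<in>ball (0::real^'n) 1. ennreal (heat_kernel 1 z) \<partial>lborel) = ennreal (heat_mass TYPE('n))"
  and heat_mass_bounds:
  "exp (-1/4) * heat_prefactor TYPE('n) 1 * unit_ball_vol (real CARD('n)) \<le> heat_mass TYPE('n)"
  "heat_mass TYPE('n) \<le> heat_prefactor TYPE('n) 1 * unit_ball_vol (real CARD('n))"
proof -
  let ?B = "ball (0::real^'n) 1"
  let ?p = "heat_prefactor TYPE('n) 1" and ?v = "unit_ball_vol (real CARD('n))"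
  let ?I = "\<integral>\<^sup>+z\<in>?B. ennreal (heat_kernel 1 z) \<partial>lborel"
  have p: "?p > 0" by (simp add: heat_prefactor_pos)
  have v: "emeasure lborel ?B = ennreal ?v" by (simp add: emeasure_ball)
  have bounds: "exp (-1/4) * ?p \<le> heat_kernel 1 z" "heat_kernel 1 z \<le> ?p" if "z \<in> ?B" for z
    using heat_kernel_bounds[of 1 "-z" 0] that by (auto simp: heat_kernel_def)
  have "?I \<le> (\<integral>\<^sup>+z. ennreal ?p * indicator ?B z \<partial>lborel)"
    using bounds by (intro nn_integral_mono) (auto simp: indicator_def intro!: ennreal_leI)
  also have "\<dots> = ennreal ?p * emeasure lborel ?B"
    by (intro nn_integral_cmult_indicator) auto
  also have "\<dots> = ennreal (?p * ?v)"
    using p by (simp add: v ennreal_mult)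
  finally have upper: "?I \<le> ennreal (?p * ?v)" .
  have "ennreal (exp (-1/4) * ?p * ?v) = ennreal (exp (-1/4) * ?p) * emeasure lborel ?B"
    using p by (subst ennreal_mult) (auto simp: v)
  also have "\<dots> = (\<integral>\<^sup>+z. ennreal (exp (-1/4) * ?p) * indicator ?B z \<partial>lborel)"
    by (intro nn_integral_cmult_indicator[symmetric]) auto
  also have "\<dots> \<le> ?I"
    using bounds by (intro nn_integral_mono) (auto simp: indicator_def intro!: ennreal_leI)
  finally have lower: "ennreal (exp (-1/4) * ?p * ?v) \<le> ?I" .
  have pos: "heat_kernel 1 z \<ge> 0" for z :: "real^'n" by (simp add: heat_kernel_def)
  have "heat_mass TYPE('n) = (LINT z|lebesgue. indicator ?B z * heat_kernel 1 z)"
    unfolding heat_mass_def set_lebesgue_integral_def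
    by (intro Bochner_Integration.integral_cong) (simp_all add: heat_kernel_def)
  also have "\<dots> = enn2real (\<integral>\<^sup>+z. ennreal (indicator ?B z * heat_kernel 1 z) \<partial>lebesgue)"
    using pos by (intro integral_eq_nn_integral measurable_completion AE_I2) (measurable, auto)
  also have "(\<integral>\<^sup>+z. ennreal (indicator ?B z * heat_kernel 1 z) \<partial>lebesgue) = ?I"
    unfolding nn_integral_completion by (intro nn_integral_cong) (auto simp: indicator_def)
  finally have mass: "heat_mass TYPE('n) = enn2real ?I" .
  \<comment> \<open>Since \<open>enn2real\<close> sends infinity to 0, finiteness is required to
    recover the integral from its real value.\<close>
  have fin: "?I < \<infinity>" using upper by (simp add: le_less_trans[OF upper])
  then show eq: "?I = ennreal (heat_mass TYPE('n))" by (simp add: mass)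
  have nn: "heat_mass TYPE('n) \<ge> 0" by (simp add: mass)
  show "exp (-1/4) * ?p * ?v \<le> heat_mass TYPE('n)"
    using lower nn unfolding eq by (simp add: ennreal_le_iff)
  show "heat_mass TYPE('n) \<le> ?p * ?v"
    using upper p unfolding eq by (subst (asm) ennreal_le_iff) auto
qed

lemma heat_mass_pos: "heat_mass TYPE('n::finite) > 0"
  by (rule less_le_trans[OF _ heat_mass_bounds(1)]) (simp add: heat_prefactor_pos)

text \<open>Under y = x + sqrt(t) z the Jacobian is absorbed by the prefactor, leaving the kernel at
  time 1 on the unit ball. Thus dividing by \<open>heat_mass\<close> gives a probability density on
  every such ball.\<close>

lemma nn_integral_heat_kernel_ball:
  fixes x :: "real^'n"
  assumes t: "t > 0"
  shows "(\<integral>\<^sup>+y\<in>ball x (sqrt t). ennreal (heat_kernel t (x - y)) \<partial>lebesgue) = ennreal (heat_mass TYPE('n))"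
proof -
  let ?g = "\<lambda>y. ennreal (heat_kernel t (x - y)) * indicator (ball x (sqrt t)) y"
  have [measurable]: "ball x (sqrt t) \<in> sets borel" by simp
  have [measurable]: "?g \<in> borel_measurable borel" by measurable
  have s: "sqrt t > 0" using t by simp
  have "(\<integral>\<^sup>+y. ?g y \<partial>lborel) =
      (\<integral>\<^sup>+y. ?g y \<partial>density (distr lborel borel (\<lambda>z. x + sqrt t *\<^sub>R z)) (\<lambda>_. ennreal (\<bar>sqrt t\<bar> ^ DIM(real^'n))))"
    using s by (subst lborel_affine[of "sqrt t" x]) auto
  also have "\<dots> = (\<integral>\<^sup>+z. ennreal (sqrt t ^ CARD('n)) * ?g (x + sqrt t *\<^sub>R z) \<partial>lborel)"
    using s by (simp add: nn_integral_density nn_integral_distr)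
  also have "\<dots> = (\<integral>\<^sup>+z\<in>ball (0::real^'n) 1. ennreal (heat_kernel 1 z) \<partial>lborel)"
  proof (rule nn_integral_cong)
    fix z :: "real^'n"
    have ball: "x + sqrt t *\<^sub>R z \<in> ball x (sqrt t) \<longleftrightarrow> z \<in> ball 0 1"
      using s by (simp add: dist_norm)
    have "sqrt t ^ CARD('n) * heat_kernel t (x - (x + sqrt t *\<^sub>R z)) =
        (heat_prefactor TYPE('n) t * sqrt t ^ CARD('n)) * exp (- (norm z)\<^sup>2 / 4)"
      using t by (simp add: heat_kernel_def heat_prefactor_def power_mult_distrib mult_ac)
    also have "\<dots> = heat_kernel 1 z"
      unfolding heat_prefactor_sqrt[OF t] by (simp add: heat_kernel_def heat_prefactor_def)
    finally have "ennreal (sqrt t ^ CARD('n)) * ennreal (heat_kernel t (x - (x + sqrt t *\<^sub>R z))) =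
        ennreal (heat_kernel 1 z)"
      using s by (subst ennreal_mult[symmetric]) (auto simp: heat_kernel_def)
    then show "ennreal (sqrt t ^ CARD('n)) * ?g (x + sqrt t *\<^sub>R z) =
        ennreal (heat_kernel 1 z) * indicator (ball 0 1) z"
      using ball by (auto simp: indicator_def)
  qed
  finally show ?thesis
    unfolding nn_integral_completion nn_integral_heat_kernel_unit_ball .
qed

lemma heat_prefactor_emeasure_ball:
  fixes x :: "real^'n"
  assumes t: "t > 0"
  shows "ennreal (heat_prefactor TYPE('n) t) * emeasure lebesgue (ball x (sqrt t)) =
    ennreal (heat_prefactor TYPE('n) 1 * unit_ball_vol (real CARD('n)))"
  using t heat_prefactor_pos[OF t, where 'n='n]
  by (simp add: emeasure_ball mult_ac flip: ennreal_mult heat_prefactor_sqrt[OF t])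

section \<open>From BLO to the heat kernel bound\<close>

text \<open>Bounding the kernel by its maximum reduces to the unweighted exponential integral, which
  costs the factor 5; the prefactor times the volume of the ball does not depend on \<open>t\<close>
  and exceeds the mass by at most e^(1/4).\<close>

lemma heat_exp_sup_le_of_BLO:
  fixes f :: "real^'n \<Rightarrow> real"
  assumes f: "f \<in> BLO"
  shows "heat_exp_sup (ln (4/3) / (4 * 15 ^ CARD('n)) / enn2real (BLO_norm f)) f \<le> ennreal (5 * exp (1/4))"
    (is "heat_exp_sup ?l f \<le> _")
proof -
  let ?p = "heat_prefactor TYPE('n)" and ?v = "unit_ball_vol (real CARD('n))"
  have "ennreal (1 / heat_mass TYPE('n)) * heat_exp_integral ?l f x t \<le> ennreal (5 * exp (1/4))"
    if t: "t > 0" for x :: "real^'n" and t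
  proof -
    let ?B = "ball x (sqrt t)"
    define m where "m = real_of_ereal (ess_inf_on ?B f)"
    have s: "sqrt t > 0" using t by auto
    have meas [measurable]: "f \<in> borel_measurable lebesgue"
      using f by (auto simp: BLO_def intro: locally_integrable_imp_measurable)
    have [measurable]: "?B \<in> sets lebesgue" by simp
    have "heat_exp_integral ?l f x t =
        (\<integral>\<^sup>+y\<in>?B. ennreal (heat_kernel t (x - y) * exp (?l * (f y - m))) \<partial>lebesgue)"
      using BLO_ess_inf_finite[OF f s, of x] by (auto simp: heat_exp_integral_def Let_def m_def)
    also have "\<dots> \<le> (\<integral>\<^sup>+y. ennreal (?p t) * (ennreal (exp (?l * (f y - m))) * indicator ?B y) \<partial>lebesgue)"
      using heat_kernel_bounds(2)[OF t] heat_prefactor_pos[OF t, where 'n='n]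
      by (intro nn_integral_mono) (auto simp: indicator_def simp flip: ennreal_mult intro!: ennreal_leI mult_right_mono)
    also have "\<dots> = ennreal (?p t) * (\<integral>\<^sup>+y\<in>?B. ennreal (exp (?l * (f y - m))) \<partial>lebesgue)"
      by (intro nn_integral_cmult) measurable
    also have "\<dots> \<le> ennreal (?p t) * (5 * emeasure lebesgue ?B)"
      using BLO_exp_integral_le[OF f s, of x] by (intro mult_left_mono) (auto simp: m_def)
    also have "\<dots> = 5 * ennreal (?p 1 * ?v)"
      unfolding heat_prefactor_emeasure_ball[OF t, of x, symmetric] by (rule mult.left_commute)
    finally have I: "heat_exp_integral ?l f x t \<le> 5 * ennreal (?p 1 * ?v)" .
    have "ennreal (1 / heat_mass TYPE('n)) * heat_exp_integral ?l f x t \<le>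
        ennreal (1 / heat_mass TYPE('n)) * (5 * ennreal (?p 1 * ?v))"
      by (intro mult_left_mono I) simp
    also have "\<dots> = ennreal (1 / heat_mass TYPE('n) * (5 * (?p 1 * ?v)))"
      using heat_mass_pos[where 'n='n] heat_prefactor_pos[of 1, where 'n='n]
      by (subst ennreal_mult) (auto simp: ennreal_mult)
    also have "1 / heat_mass TYPE('n) * (5 * (?p 1 * ?v)) \<le> 5 * exp (1/4)"
  proof -
      have "exp (1/4) * (exp (-1/4) * ?p 1 * ?v) \<le> exp (1/4) * heat_mass TYPE('n)"
        by (intro mult_left_mono heat_mass_bounds) simp
      then have "?p 1 * ?v \<le> exp (1/4) * heat_mass TYPE('n)"
        by (simp add: mult.assoc[symmetric] flip: exp_add)
      then show ?thesis using heat_mass_pos[where 'n='n] by (simp add: field_simps)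
    qed
    finally show ?thesis
      by (simp add: ennreal_leI)
  qed
  then show ?thesis
    unfolding heat_exp_sup_def by (auto intro!: SUP_least)
qed

section \<open>From the heat kernel bound to BLO\<close>

lemma mean_oscillation_le_of_heat_exp_sup:
  fixes f :: "real^'n \<Rightarrow> real"
  assumes f: "locally_integrable f" and lam: "lam > 0" and A: "A \<ge> 1"
    and sup: "heat_exp_sup lam f \<le> ennreal A" and r: "r > 0"
  shows "(\<integral>\<^sup>+x\<in>ball c r. e2ennreal (ereal (f x) - ess_inf_on (ball c r) f) \<partial>lebesgue)
    / emeasure lebesgue (ball c r) \<le> ennreal (exp (1/4) / lam * ln A)"
proof -
  \<comment> \<open>The time at which the heat ball is exactly the given ball.\<close>
  define t where "t = r\<^sup>2"
  have t: "t > 0" "sqrt t = r" using r by (auto simp: t_def)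
  let ?B = "ball c r"
  let ?th = "heat_mass TYPE('n)" and ?v = "unit_ball_vol (real CARD('n))" and ?p = "heat_prefactor TYPE('n)"
  define w where "w y = heat_kernel t (c - y) / ?th" for y
  have th: "?th > 0" by (rule heat_mass_pos)
  have w0: "w y \<ge> 0" for y using th by (simp add: w_def heat_kernel_def)
  have [measurable]: "f \<in> borel_measurable lebesgue"
    using f by (rule locally_integrable_imp_measurable)
  have "(\<lambda>y. w y) \<in> borel_measurable borel" unfolding w_def by measurable
  then have [measurable]: "w \<in> borel_measurable lebesgue" by (intro measurable_completion) simp
  have Bm [measurable]: "?B \<in> sets lebesgue" "?B \<in> sets borel" by simp_all
  have km [measurable]: "(\<lambda>y. heat_kernel t (c - y)) \<in> borel_measurable lebesgue"
    by (intro measurable_completion) simp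
  have le: "ennreal (1 / ?th) * heat_exp_integral lam f c t \<le> ennreal A"
    using t by (intro order_trans[OF _ sup]) (auto simp: heat_exp_sup_def intro!: SUP_upper2[of "(c, t)"])
  \<comment> \<open>The infinite branch of \<open>heat_exp_integral\<close> is incompatible with the
    finite bound \<open>A\<close>.\<close>
  have ninf: "ess_inf_on ?B f \<noteq> - \<infinity>"
  proof
    assume "ess_inf_on ?B f = - \<infinity>"
    then have "ennreal (1 / ?th) * \<infinity> \<le> ennreal A"
      using le t by (simp add: heat_exp_integral_def)
    then show False using th by (simp add: ennreal_mult_top top_unique)
  qed
  obtain v where v: "v > 0" "emeasure lebesgue ?B = ennreal v"
    using emeasure_lebesgue_ball_real[OF r] .
  define m where "m = real_of_ereal (ess_inf_on ?B f)"
  have m: "ess_inf_on ?B f = ereal m"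
    using ninf ess_inf_on_neq_infinity[of ?B f] v by (auto simp: m_def ereal_real)
  have one: "(\<integral>\<^sup>+y\<in>?B. ennreal (w y) \<partial>lebesgue) = 1"
  proof -
    have "(\<integral>\<^sup>+y\<in>?B. ennreal (w y) \<partial>lebesgue) =
        (\<integral>\<^sup>+y. (ennreal (heat_kernel t (c - y)) * indicator ?B y) * ennreal (1 / ?th) \<partial>lebesgue)"
      using th by (intro nn_integral_cong) (auto simp: w_def indicator_def heat_kernel_def simp flip: ennreal_mult)
    also have "\<dots> = (\<integral>\<^sup>+y\<in>?B. ennreal (heat_kernel t (c - y)) \<partial>lebesgue) * ennreal (1 / ?th)"
      by (intro nn_integral_multc) measurable
    also have "\<dots> = ennreal ?th * ennreal (1 / ?th)"
      using nn_integral_heat_kernel_ball[OF t(1), of c] t by simp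
    also have "\<dots> = 1" using th by (simp flip: ennreal_mult)
    finally show ?thesis .
  qed
  have expA: "(\<integral>\<^sup>+y\<in>?B. ennreal (w y * exp (lam * (f y - m))) \<partial>lebesgue) \<le> ennreal A"
  proof -
    have "(\<integral>\<^sup>+y\<in>?B. ennreal (w y * exp (lam * (f y - m))) \<partial>lebesgue) =
        (\<integral>\<^sup>+y. ennreal (1 / ?th) * (ennreal (heat_kernel t (c - y) * exp (lam * (f y - m))) * indicator ?B y) \<partial>lebesgue)"
      using th by (intro nn_integral_cong) (auto simp: w_def indicator_def heat_kernel_def simp flip: ennreal_mult)
    also have "\<dots> = ennreal (1 / ?th) * heat_exp_integral lam f c t"
      using t m by (subst nn_integral_cmult) (measurable, simp add: heat_exp_integral_def)
    finally show ?thesis using le by simp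
  qed
  text \<open>Jensen's inequality for the probability density \<open>w\<close>, in the form of the tangent line
    \<open>u + 1 \<le> e\<^sup>u / A + ln A\<close> at \<open>u = ln A\<close>.\<close>
  let ?u = "\<lambda>y. lam * (f y - m)"
  have AEm: "AE y in lebesgue. y \<in> ?B \<longrightarrow> m \<le> f y"
    using AE_ess_inf_on_le[of ?B f] by (simp add: m)
  \<comment> \<open>The total mass 1 of \<open>w\<close> is added on the left and cancelled at the
    end: \<open>ln A - 1\<close> may be negative and would be truncated in
    \<open>ennreal\<close>.\<close>
  have "(\<integral>\<^sup>+y\<in>?B. ennreal (w y * ?u y) \<partial>lebesgue) + 1 =
      (\<integral>\<^sup>+y. ennreal (w y * ?u y) * indicator ?B y + ennreal (w y) * indicator ?B y \<partial>lebesgue)"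
    by (subst nn_integral_add) (auto simp: one)
  also have "\<dots> \<le> (\<integral>\<^sup>+y. ennreal (1 / A) * (ennreal (w y * exp (?u y)) * indicator ?B y) +
      ennreal (ln A) * (ennreal (w y) * indicator ?B y) \<partial>lebesgue)"
  proof (rule nn_integral_mono_AE, use AEm in eventually_elim)
    fix y assume y: "y \<in> ?B \<longrightarrow> m \<le> f y"
    show "ennreal (w y * ?u y) * indicator ?B y + ennreal (w y) * indicator ?B y \<le>
      ennreal (1 / A) * (ennreal (w y * exp (?u y)) * indicator ?B y) +
      ennreal (ln A) * (ennreal (w y) * indicator ?B y)"
    proof (cases "y \<in> ?B")
      case True
      then have u: "?u y \<ge> 0" using y lam by simp
      have "?u y + 1 \<le> exp (?u y) / A + ln A"
        using exp_ge_add_one_self[of "?u y - ln A"] A by (simp add: exp_diff)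
      then have "w y * (?u y + 1) \<le> w y * (exp (?u y) / A + ln A)"
        by (intro mult_left_mono w0)
      then have "w y * ?u y + w y \<le> 1 / A * (w y * exp (?u y)) + ln A * w y"
        by (simp add: algebra_simps)
      then have "ennreal (w y * ?u y + w y) \<le> ennreal (1 / A * (w y * exp (?u y)) + ln A * w y)"
        by (rule ennreal_leI)
      moreover have "ennreal (1 / A * (w y * exp (?u y)) + ln A * w y) =
          ennreal (1 / A) * ennreal (w y * exp (?u y)) + ennreal (ln A) * ennreal (w y)"
        using w0[of y] A ennreal_mult[of "1 / A" "w y * exp (?u y)"] ennreal_mult[of "ln A" "w y"]
        by (simp add: ennreal_plus)
      ultimately show ?thesis
        using True u w0[of y] by (simp add: ennreal_plus)
    qed simp
  qed
  also have "\<dots> = ennreal (1 / A) * (\<integral>\<^sup>+y\<in>?B. ennreal (w y * exp (?u y)) \<partial>lebesgue) + ennreal (ln A)"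
    by (subst nn_integral_add, measurable, subst (1 2) nn_integral_cmult) (auto simp: one)
  also have "\<dots> \<le> ennreal (1 / A) * ennreal A + ennreal (ln A)"
    by (intro add_right_mono mult_left_mono expA) simp
  also have "\<dots> = ennreal (ln A) + 1"
    using A by (simp add: add.commute flip: ennreal_mult)
  finally have jensen: "(\<integral>\<^sup>+y\<in>?B. ennreal (w y * ?u y) \<partial>lebesgue) \<le> ennreal (ln A)"
    by (simp add: ennreal_add_left_cancel_le add.commute[of _ 1])
  let ?q = "lam * exp (-1/4) / v"
  have q: "?q > 0" using v lam by simp
  \<comment> \<open>The kernel is bounded below and the mass above by its prefactor bound without
    exponential loss, so only one factor e^(-1/4) is lost.\<close>
  have wlow: "exp (-1/4) / v \<le> w y" if "y \<in> ?B" for y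
  proof -
    have "ennreal (?p t * v) = ennreal (?p 1 * ?v)"
      using heat_prefactor_emeasure_ball[OF t(1), of c] t v heat_prefactor_pos[OF t(1), where 'n='n]
      by (simp add: ennreal_mult)
    then have eq: "?p t * v = ?p 1 * ?v"
      using heat_prefactor_pos[OF t(1), where 'n='n] heat_prefactor_pos[of 1, where 'n='n] v
      by (subst (asm) ennreal_inj) auto
    have "exp (-1/4) * ?th \<le> exp (-1/4) * (?p t * v)"
      unfolding eq by (intro mult_left_mono heat_mass_bounds) simp
    also have "\<dots> = (exp (-1/4) * ?p t) * v" by simp
    also have "\<dots> \<le> heat_kernel t (c - y) * v"
      using heat_kernel_bounds(1)[OF t(1), of y c] that t v by (intro mult_right_mono) auto
    finally show ?thesis using th v by (simp add: w_def field_simps)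
  qed
  let ?J = "\<integral>\<^sup>+x\<in>?B. ennreal (f x - m) \<partial>lebesgue"
  have "ennreal ?q * ?J = (\<integral>\<^sup>+y. ennreal ?q * (ennreal (f y - m) * indicator ?B y) \<partial>lebesgue)"
    by (intro nn_integral_cmult[symmetric]) measurable
  also have "\<dots> \<le> (\<integral>\<^sup>+y\<in>?B. ennreal (w y * ?u y) \<partial>lebesgue)"
  proof (rule nn_integral_mono_AE, use AEm in eventually_elim)
    fix y assume y: "y \<in> ?B \<longrightarrow> m \<le> f y"
    show "ennreal ?q * (ennreal (f y - m) * indicator ?B y) \<le> ennreal (w y * ?u y) * indicator ?B y"
    proof (cases "y \<in> ?B")
      case True
      then have "exp (-1/4) / v * ?u y \<le> w y * ?u y"
        using y lam by (intro mult_right_mono wlow) auto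
      then have "ennreal (?q * (f y - m)) \<le> ennreal (w y * ?u y)"
        by (intro ennreal_leI) (simp add: mult_ac)
      then have "ennreal ?q * ennreal (f y - m) \<le> ennreal (w y * ?u y)"
        using q True y by (subst ennreal_mult[symmetric]) auto
      then show ?thesis using True by simp
    qed simp
  qed
  also note jensen
  finally have *: "ennreal ?q * ?J \<le> ennreal (ln A)" .
  have "?J = ennreal (1 / ?q) * (ennreal ?q * ?J)"
    using v lam by (subst mult.assoc[symmetric], subst ennreal_mult[symmetric]) auto
  also have "\<dots> \<le> ennreal (1 / ?q) * ennreal (ln A)"
    by (intro mult_left_mono *) simp
  also have "\<dots> = ennreal (1 / ?q * ln A)"
    using v lam A by (intro ennreal_mult[symmetric]) auto
  also have "1 / ?q * ln A = v * (exp (1/4) / lam * ln A)"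
    using v lam by (simp add: exp_minus field_simps)
  also have "ennreal \<dots> = ennreal v * ennreal (exp (1/4) / lam * ln A)"
    using v lam A by (intro ennreal_mult) auto
  finally have "?J / ennreal v \<le> ennreal (exp (1/4) / lam * ln A)"
    using v by (intro divide_le_posI_ennreal) auto
  then show ?thesis by (simp only: m v ereal_minus e2ennreal_ereal)
qed

theorem proposition2p3:
  shows "(\<exists>\<alpha>>0. \<exists>A>1. \<forall>f :: real^'n \<Rightarrow> real.
            f \<in> BLO \<longrightarrow> \<not> (\<exists>c. AE x in lebesgue. f x = c) \<longrightarrow>
            heat_exp_sup (\<alpha> / enn2real (BLO_norm f)) f \<le> ennreal A)
       \<and> (\<forall>(f :: real^'n \<Rightarrow> real) (lam::real) (A::real).
            locally_integrable f \<longrightarrow> lam > 0 \<longrightarrow> A \<ge> 1 \<longrightarrow>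
            heat_exp_sup lam f \<le> ennreal A \<longrightarrow>
            f \<in> BLO \<and> BLO_norm f \<le> ennreal (exp (1/4) / lam * ln A))"
proof (intro conjI allI impI)
  \<comment> \<open>The witnesses are \<open>5 * exp (1/4)\<close> for \<open>A\<close> and
    \<open>ln (4/3) / (4 * 15 ^ CARD('n))\<close> for \<alpha>, both depending on the dimension at
    most.\<close>
  have "1 < 5 * exp (1/4 :: real)"
    using exp_ge_add_one_self[of "1/4"] by simp
  moreover have "ln (4/3) / (4 * 15 ^ CARD('n)) > (0::real)" by simp
  ultimately show "\<exists>\<alpha>>0. \<exists>A>1. \<forall>f :: real^'n \<Rightarrow> real.
            f \<in> BLO \<longrightarrow> \<not> (\<exists>c. AE x in lebesgue. f x = c) \<longrightarrow>
            heat_exp_sup (\<alpha> / enn2real (BLO_norm f)) f \<le> ennreal A"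
    using heat_exp_sup_le_of_BLO[where 'n='n] by blast
next
  fix f :: "real^'n \<Rightarrow> real" and lam A :: real
  assume *: "locally_integrable f" "lam > 0" "A \<ge> 1" "heat_exp_sup lam f \<le> ennreal A"
  show norm: "BLO_norm f \<le> ennreal (exp (1/4) / lam * ln A)"
    unfolding BLO_norm_def
    using mean_oscillation_le_of_heat_exp_sup[OF *] by (intro SUP_least) auto
  show "f \<in> BLO"
    using *(1) le_less_trans[OF norm] by (simp add: BLO_def)
qed

end
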